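(* Let $I\subseteq\mathbb{R}$ be an interval, let $a,b,c,f_2\in C^\infty(I)$ be real-valued with $f_2(x)+b^2(x)\ge0$ on $I$, fix a choice of sign $\pm$ (the same throughout), assume $-b(x)\pm\sqrt{f_2(x)+b^2(x)}\ne0$ on $I$, and let $C_{\pm5}\in\mathbb{R}$. Put $$E_\pm(x)=e^{-\frac12\int^{x}\frac{f_2(\phi)}{-b(\phi)\pm\sqrt{f_2(\phi)+b^2(\phi)}}\,d\phi},$$ and assume $C_{\pm5}+\int^{x}a(\psi)E_\pm(\psi)\,d\psi\neq0$ on $I$. Suppose that for all $x\in I$ $$c(x)=\frac{\left[-b(x)\pm\sqrt{f_2(x)+b^2(x)}\right]E_\pm(x)}{2\left[C_{\pm5}+\int^{x}a(\psi)E_\pm(\psi)\,d\psi\right]} .$$ Then the general solution of the Riccati equation $\frac{dy_\pm}{dx}=a(x)+b(x)y_\pm+c(x)y_\pm^2$ is $$y_\pm(x)=\frac{e^{\pm\int^{x}\sqrt{f_2(\phi)+b^2(\phi)}\,d\phi}}{C_{\pm6}-\int^{x}\frac{\left[-b(\omega)\pm\sqrt{f_2(\omega)+b^2(\omega)}\right]E_\pm(\omega)}{2\left[C_{\pm5}+\int^{\omega}a(\psi)E_\pm(\psi)\,d\psi\right]}\,e^{\pm\int^{\omega}\sqrt{f_2(\phi)+b^2(\phi)}\,d\phi}\,d\omega}+\left[C_{\pm5}+\int^{x}a(\psi)E_\pm(\psi)\,d\psi\right]E_\pm(x)^{-1},$$ where $C_{\pm6}$ is an arbitrary constant of integration.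
   Context: $\int^{x}g(\phi)\,d\phi$ denotes a fixed antiderivative of $g$ on $I$, the same one wherever the same integrand occurs. "The general solution is $y(x)=\frac{G(x)}{C-H(x)}+y_p(x)$ with $C$ an arbitrary constant" means: for every real $C$, this function satisfies the equation on every subinterval of $I$ on which $C-H$ does not vanish; and conversely every differentiable solution on a nondegenerate subinterval of $I$ is either of this form for some real $C$ (with nonvanishing denominator there) or equal to $y_p$ (the limiting case $C=\infty$). *)

theory Defs
  imports "HOL-Analysis.Analysis"
begin

(* C^infinity on an interval: D n is the n-th derivative, one-sided at those endpoints that
   belong to I.  Values of f outside I are irrelevant. *)
definition smooth_on_interval :: "real set \<Rightarrow> (real \<Rightarrow> real) \<Rightarrow> bool" where
  "smooth_on_interval I f \<longleftrightarrow>
     (\<exists>D :: nat \<Rightarrow> real \<Rightarrow> real.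
        (\<forall>x\<in>I. D 0 x = f x) \<and>
        (\<forall>n. \<forall>x\<in>I. (D n has_real_derivative D (Suc n) x) (at x within I)))"

definition antiderivative_on :: "real set \<Rightarrow> (real \<Rightarrow> real) \<Rightarrow> (real \<Rightarrow> real) \<Rightarrow> bool" where
  "antiderivative_on I g F \<longleftrightarrow> (\<forall>x\<in>I. (F has_real_derivative g x) (at x within I))"

definition subinterval :: "real set \<Rightarrow> real set \<Rightarrow> bool" where
  "subinterval J I \<longleftrightarrow> is_interval J \<and> J \<subseteq> I"

definition nondegenerate :: "real set \<Rightarrow> bool" where
  "nondegenerate J \<longleftrightarrow> (\<exists>p\<in>J. \<exists>q\<in>J. p < q)"

definition riccati_solution_on ::
  "real set \<Rightarrow> (real \<Rightarrow> real) \<Rightarrow> (real \<Rightarrow> real) \<Rightarrow> (real \<Rightarrow> real) \<Rightarrow> (real \<Rightarrow> real) \<Rightarrow> bool" where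
  "riccati_solution_on J a b c y \<longleftrightarrow>
     (\<forall>x\<in>J. (y has_real_derivative (a x + b x * y x + c x * (y x)\<^sup>2)) (at x within J))"

(* "The general solution on I is G / (C - H) + yp with C arbitrary"; the alternative y = yp in
   the converse direction is the limiting case C = infinity. *)
definition riccati_general_solution ::
  "real set \<Rightarrow> (real \<Rightarrow> real) \<Rightarrow> (real \<Rightarrow> real) \<Rightarrow> (real \<Rightarrow> real) \<Rightarrow>
   (real \<Rightarrow> real) \<Rightarrow> (real \<Rightarrow> real) \<Rightarrow> (real \<Rightarrow> real) \<Rightarrow> bool" where
  "riccati_general_solution I a b c G H yp \<longleftrightarrow>
     (\<forall>C J. subinterval J I \<and> (\<forall>x\<in>J. C - H x \<noteq> 0) \<longrightarrow>
        riccati_solution_on J a b c (\<lambda>x. G x / (C - H x) + yp x)) \<and>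
     (\<forall>J y. subinterval J I \<and> nondegenerate J \<and> riccati_solution_on J a b c y \<longrightarrow>
        (\<exists>C. \<forall>x\<in>J. C - H x \<noteq> 0 \<and> y x = G x / (C - H x) + yp x) \<or>
        (\<forall>x\<in>J. y x = yp x))"

end

theory Submission
  imports Defs
begin

text \<open>
  One particular solution of a Riccati equation determines all of them. If \<open>yp\<close> is a solution
  and \<open>G\<close> is a nowhere vanishing solution of the linear equation
  \<open>G' = (b + 2 * c * yp) * G\<close>, then \<open>y = yp + G * v\<close> solves the Riccati equation exactly when
  \<open>v' = c * G * v\<^sup>2\<close>. With \<open>H' = c * G\<close> this reads \<open>(1 / v + H)' = 0\<close> as long as \<open>v \<noteq> 0\<close>, so
  \<open>v = 1 / (C - H)\<close>. Lemma \<open>inverse_square_ode_solution\<close> shows that a solution \<open>v\<close> that is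
  nonzero somewhere is nonzero everywhere, which leaves only \<open>v = 0\<close>, that is \<open>y = yp\<close>, as a
  further solution; lemma \<open>riccati_general_solution_from_particular\<close> puts this together.

  For the equation at hand the prescribed \<open>c\<close> is chosen such that \<open>yp = (C5 + Q) / E\<close> satisfies
  \<open>2 * c * yp = R\<close>. Hence \<open>b + 2 * c * yp = s * sqrt (f2 + b\<^sup>2)\<close>, whose exponential
  integral is \<open>G\<close>. Moreover, \<open>R\<close> is a root of \<open>R\<^sup>2 + 2 * b * R = f2\<close>, so
  \<open>f2 / (2 * R) = b + R / 2 = b + c * yp\<close>. The left-hand side is the coefficient of \<open>yp\<close> in the
  linear equation \<open>yp' = a + f2 / (2 * R) * yp\<close>, which follows from the definitions of \<open>E\<close> and
  \<open>Q\<close>; so \<open>yp\<close> solves the Riccati equation.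
\<close>

text \<open>
  The set where \<open>v x * (C - H x) = 1\<close> is closed by continuity. It is open because \<open>v\<close> does not
  vanish on it, so that \<open>1 / v + H\<close> is constant near each of its points. On a connected domain
  it is therefore everything. This takes the place of a uniqueness theorem for initial value
  problems.
\<close>

lemma inverse_square_ode_solution:
  fixes v H h :: "real \<Rightarrow> real"
  assumes J: "is_interval J"
    and v: "\<And>x. x \<in> J \<Longrightarrow> (v has_real_derivative h x * (v x)\<^sup>2) (at x within J)"
    and H: "\<And>x. x \<in> J \<Longrightarrow> (H has_real_derivative h x) (at x within J)"
    and p: "p \<in> J" "v p \<noteq> 0"
  shows "\<exists>C. \<forall>x\<in>J. v x * (C - H x) = 1"
proof -
  define C where "C = inverse (v p) + H p"
  define A where "A = {x \<in> J. v x * (C - H x) = 1}"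
  have cv: "continuous_on J v" and cH: "continuous_on J H"
    by (rule DERIV_continuous_on, erule v, rule DERIV_continuous_on, erule H)
  have "closedin (top_of_set J) A"
    unfolding A_def by (intro continuous_closedin_preimage_constant continuous_intros cv cH)
  moreover have "openin (top_of_set J) A"
    unfolding openin_contains_ball
  proof (intro conjI ballI)
    show "A \<subseteq> J" by (auto simp: A_def)
  next
    fix x assume x: "x \<in> A"
    hence xJ: "x \<in> J" and vx: "v x \<noteq> 0" and eq: "v x * (C - H x) = 1"
      by (auto simp: A_def)
    obtain e where e: "e > 0" and ne: "\<And>y. y \<in> J \<Longrightarrow> dist x y < e \<Longrightarrow> v y \<noteq> 0"
      using continuous_on_avoid[OF cv xJ vx] by auto
    define B where "B = ball x e \<inter> J"
    have "convex B"
      using J unfolding B_def by (intro convex_Int convex_ball) (simp add: is_interval_convex_1)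
    moreover have "((\<lambda>y. inverse (v y) + H y) has_real_derivative 0) (at y within B)"
      if y: "y \<in> B" for y
    proof -
      have yJ: "y \<in> J" and vy: "v y \<noteq> 0" using y ne by (auto simp: B_def)
      have sub: "B \<subseteq> J" by (auto simp: B_def)
      show ?thesis
        by (rule DERIV_cong[OF DERIV_add[OF DERIV_inverse'[OF DERIV_subset[OF v[OF yJ] sub] vy]
              DERIV_subset[OF H[OF yJ] sub]]])
          (simp add: vy power2_eq_square)
    qed
    ultimately obtain k where k: "\<And>y. y \<in> B \<Longrightarrow> inverse (v y) + H y = k"
      using has_field_derivative_zero_constant[of B "\<lambda>y. inverse (v y) + H y"] by blast
    have "x \<in> B" using xJ e by (auto simp: B_def)
    hence kC: "k = C" using k[of x] vx eq by (auto simp: field_simps)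
    have "B \<subseteq> A"
    proof
      fix y assume y: "y \<in> B"
      hence "y \<in> J" "v y \<noteq> 0" using ne by (auto simp: B_def)
      moreover have "C - H y = inverse (v y)" using k[OF y] kC by simp
      ultimately show "y \<in> A" by (simp add: A_def)
    qed
    thus "\<exists>e>0. ball x e \<inter> J \<subseteq> A" using e unfolding B_def by blast
  qed
  moreover have "connected J"
    using J by (simp add: is_interval_connected_1)
  ultimately have "A = {} \<or> A = J"
    unfolding connected_clopen by blast
  moreover have "p \<in> A"
    using p by (simp add: A_def C_def)
  ultimately have "A = J" by blast
  thus ?thesis unfolding A_def by blast
qed

text \<open>
  Substituting \<open>y = yp + G * v\<close> removes the constant and the linear term of the Riccati equation,
  because \<open>yp\<close> accounts for the former and \<open>G\<close> for the latter.
\<close>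

lemma riccati_general_solution_from_particular:
  assumes yp: "riccati_solution_on I a b c yp"
    and G: "\<And>x. x \<in> I \<Longrightarrow>
      (G has_real_derivative (b x + 2 * c x * yp x) * G x) (at x within I)"
    and G0: "\<And>x. x \<in> I \<Longrightarrow> G x \<noteq> 0"
    and H: "antiderivative_on I (\<lambda>x. c x * G x) H"
  shows "riccati_general_solution I a b c G H yp"
  unfolding riccati_general_solution_def
proof (intro conjI allI impI)
  fix C J assume J: "subinterval J I \<and> (\<forall>x\<in>J. C - H x \<noteq> 0)"
  show "riccati_solution_on J a b c (\<lambda>x. G x / (C - H x) + yp x)"
    unfolding riccati_solution_on_def
  proof
    fix x assume x: "x \<in> J"
    hence xI: "x \<in> I" and sub: "J \<subseteq> I" and ne: "C - H x \<noteq> 0"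
      using J by (auto simp: subinterval_def)
    have dG: "(G has_real_derivative (b x + 2 * c x * yp x) * G x) (at x within J)"
      using G[OF xI] sub by (rule DERIV_subset)
    have dH: "(H has_real_derivative c x * G x) (at x within J)"
      using H xI sub by (auto simp: antiderivative_on_def intro: DERIV_subset)
    have dyp: "(yp has_real_derivative a x + b x * yp x + c x * (yp x)\<^sup>2) (at x within J)"
      using yp xI sub by (auto simp: riccati_solution_on_def intro: DERIV_subset)
    define g where "g = G x"
    define d where "d = C - H x"
    have "((b x + 2 * c x * yp x) * g * d - g * (0 - c x * g)) / (d * d)
            + (a x + b x * yp x + c x * (yp x)\<^sup>2)
        = a x + b x * (g / d + yp x) + c x * (g / d + yp x)\<^sup>2"
      using ne unfolding d_def[symmetric]
      by (simp add: field_simps power2_eq_square)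
    note slope_eq = this[unfolded g_def d_def]
    show "((\<lambda>x. G x / (C - H x) + yp x) has_real_derivative
        a x + b x * (G x / (C - H x) + yp x) + c x * (G x / (C - H x) + yp x)\<^sup>2) (at x within J)"
      by (rule DERIV_cong[OF DERIV_add[OF DERIV_divide[OF dG DERIV_diff[OF DERIV_const dH] ne] dyp]
            slope_eq])
  qed
next
  fix J y assume J: "subinterval J I \<and> nondegenerate J \<and> riccati_solution_on J a b c y"
  hence sub: "J \<subseteq> I" and int: "is_interval J" by (auto simp: subinterval_def)
  define v where "v = (\<lambda>x. (y x - yp x) / G x)"
  have dH: "(H has_real_derivative c x * G x) (at x within J)" if "x \<in> J" for x
    using H that sub by (auto simp: antiderivative_on_def intro: DERIV_subset)
  have dv: "(v has_real_derivative c x * G x * (v x)\<^sup>2) (at x within J)" if x: "x \<in> J" for x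
  proof -
    have xI: "x \<in> I" using x sub by auto
    have dG: "(G has_real_derivative (b x + 2 * c x * yp x) * G x) (at x within J)"
      using G[OF xI] sub by (rule DERIV_subset)
    have dyp: "(yp has_real_derivative a x + b x * yp x + c x * (yp x)\<^sup>2) (at x within J)"
      using yp xI sub by (auto simp: riccati_solution_on_def intro: DERIV_subset)
    have dy: "(y has_real_derivative a x + b x * y x + c x * (y x)\<^sup>2) (at x within J)"
      using J x by (auto simp: riccati_solution_on_def)
    have "((a x + b x * y x + c x * (y x)\<^sup>2 - (a x + b x * yp x + c x * (yp x)\<^sup>2)) * G x
            - (y x - yp x) * ((b x + 2 * c x * yp x) * G x)) / (G x * G x)
        = c x * G x * (v x)\<^sup>2"
      using G0[OF xI] unfolding v_def by (simp add: field_simps power2_eq_square)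
    thus ?thesis
      using DERIV_divide[OF DERIV_diff[OF dy dyp] dG G0[OF xI]] unfolding v_def by simp
  qed
  show "(\<exists>C. \<forall>x\<in>J. C - H x \<noteq> 0 \<and> y x = G x / (C - H x) + yp x) \<or> (\<forall>x\<in>J. y x = yp x)"
  proof (cases "\<forall>x\<in>J. v x = 0")
    case True
    have "y x = yp x" if "x \<in> J" for x
    proof -
      have "v x = 0" "G x \<noteq> 0" using True that G0 sub by auto
      thus ?thesis by (simp add: v_def)
    qed
    thus ?thesis by blast
  next
    case False
    then obtain p where "p \<in> J" "v p \<noteq> 0" by blast
    then obtain C where C: "\<And>x. x \<in> J \<Longrightarrow> v x * (C - H x) = 1"
      using inverse_square_ode_solution[OF int dv dH] by blast
    have "C - H x \<noteq> 0 \<and> y x = G x / (C - H x) + yp x" if x: "x \<in> J" for x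
    proof -
      have g: "G x \<noteq> 0" using G0 x sub by auto
      have ne: "C - H x \<noteq> 0" using C[OF x] by auto
      have "y x - yp x = G x * v x" using g by (simp add: v_def)
      also have "v x = 1 / (C - H x)" using C[OF x] ne by (simp add: field_simps)
      finally show ?thesis using ne by simp
    qed
    thus ?thesis by blast
  qed
qed

theorem theorem4:
  fixes I :: "real set"
    and a b c f2 :: "real \<Rightarrow> real"
    and s C5 :: real
    and R E P Q S H :: "real \<Rightarrow> real"
  assumes "is_interval I"
    and "smooth_on_interval I a" "smooth_on_interval I b"
        "smooth_on_interval I c" "smooth_on_interval I f2"
    and "\<forall>x\<in>I. f2 x + (b x)\<^sup>2 \<ge> 0"
    and "s = 1 \<or> s = -1"
    and "R = (\<lambda>x. - b x + s * sqrt (f2 x + (b x)\<^sup>2))"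
    and "\<forall>x\<in>I. R x \<noteq> 0"
    and "antiderivative_on I (\<lambda>x. f2 x / R x) P"
    and "E = (\<lambda>x. exp (- (1/2) * P x))"
    and "antiderivative_on I (\<lambda>x. a x * E x) Q"
    and "\<forall>x\<in>I. C5 + Q x \<noteq> 0"
    and "\<forall>x\<in>I. c x = R x * E x / (2 * (C5 + Q x))"
    and "antiderivative_on I (\<lambda>x. sqrt (f2 x + (b x)\<^sup>2)) S"
    and "antiderivative_on I (\<lambda>x. R x * E x / (2 * (C5 + Q x)) * exp (s * S x)) H"
  shows "riccati_general_solution I a b c
           (\<lambda>x. exp (s * S x)) H (\<lambda>x. (C5 + Q x) * inverse (E x))"
proof -
  define w where "w = (\<lambda>x. sqrt (f2 x + (b x)\<^sup>2))"
  define yp where "yp = (\<lambda>x. (C5 + Q x) * inverse (E x))"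
  have R: "R x = - b x + s * w x" for x
    using assms(8) by (simp add: w_def)
  have E0: "E x \<noteq> 0" for x
    using assms(11) by simp
  have cyp: "2 * c x * yp x = R x" if "x \<in> I" for x
  proof -
    have "C5 + Q x \<noteq> 0" "c x = R x * E x / (2 * (C5 + Q x))"
      using assms(13,14) that by auto
    hence "2 * (C5 + Q x) * c x = R x * E x"
      by (simp del: distrib_left_numeral)
    moreover have "2 * c x * yp x = (2 * (C5 + Q x) * c x) * inverse (E x)"
      by (simp add: yp_def)
    ultimately show ?thesis
      using E0[of x] by simp
  qed
  have quadratic: "f2 x = R x * (R x + 2 * b x)" if "x \<in> I" for x
  proof -
    have "R x * (R x + 2 * b x) = s\<^sup>2 * (w x)\<^sup>2 - (b x)\<^sup>2"
      by (simp add: R power2_eq_square algebra_simps)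
    also have "s\<^sup>2 = 1" using assms(7) by auto
    also have "(w x)\<^sup>2 = f2 x + (b x)\<^sup>2" using assms(6) that by (simp add: w_def)
    finally show ?thesis by simp
  qed
  have "riccati_solution_on I a b c yp"
    unfolding riccati_solution_on_def
  proof
    fix x assume x: "x \<in> I"
    have r: "f2 x / R x = R x + 2 * b x"
      using quadratic[OF x] assms(9) x by simp
    have dP: "(P has_real_derivative R x + 2 * b x) (at x within I)"
      using assms(10) x r by (auto simp: antiderivative_on_def)
    have dE: "(E has_real_derivative - (1/2) * (R x + 2 * b x) * E x) (at x within I)"
      unfolding assms(11) by (auto intro!: derivative_eq_intros dP)
    have dQ: "(Q has_real_derivative a x * E x) (at x within I)"
      using assms(12) x by (auto simp: antiderivative_on_def)
    have "(yp has_real_derivative a x + (b x + R x / 2) * yp x) (at x within I)"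
      unfolding yp_def using E0[of x]
      by (auto intro!: derivative_eq_intros dE dQ simp: field_simps)
    moreover have "R x / 2 = c x * yp x"
      using cyp[OF x] by simp
    ultimately show
      "(yp has_real_derivative a x + b x * yp x + c x * (yp x)\<^sup>2) (at x within I)"
      by (simp add: power2_eq_square algebra_simps)
  qed
  moreover have "((\<lambda>x. exp (s * S x)) has_real_derivative
      (b x + 2 * c x * yp x) * exp (s * S x)) (at x within I)" if x: "x \<in> I" for x
  proof -
    have "(S has_real_derivative w x) (at x within I)"
      using assms(15) x by (auto simp: antiderivative_on_def w_def)
    moreover have "b x + 2 * c x * yp x = s * w x"
      using cyp[OF x] R[of x] by simp
    ultimately show ?thesis
      by (auto intro!: derivative_eq_intros)
  qed
  moreover have "antiderivative_on I (\<lambda>x. c x * exp (s * S x)) H"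
    using assms(14,16) by (simp add: antiderivative_on_def)
  ultimately show ?thesis
    unfolding yp_def[symmetric] by (intro riccati_general_solution_from_particular) simp_all
qed

end
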